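(* Let $1\le r\leq s$ be integers and let $K_{r,s}$ be the complete bipartite graph with partite sets of sizes $r$ and $s$, of order $n=r+s\geq 3$. Then $$\psi(K_{r,s})=\begin{cases} n-1 & \text{if } r\leq 2,\\ n-2 & \text{if } r>2.\end{cases}$$
   Context: $d(u,v)$ denotes the length of a shortest path between $u$ and $v$. Two vertices $u,v$ of a connected graph $G$ are doubly resolved by vertices $x,y$ of $G$ if $d(v,x)-d(u,x)\neq d(v,y)-d(u,y)$. A set $W\subseteq V(G)$ is a doubly resolving set for $G$ if every two distinct vertices of $G$ are doubly resolved by some two vertices of $W$. The doubly resolving number $\psi(G)$ is the minimum cardinality of a doubly resolving set for $G$. *)

theory Defs
  imports "Graph_Theory.Graph_Theory"
begin

text \<open>
  Only meaningful when \<open>v\<close> is reachable from \<open>u\<close> (\<open>LEAST\<close> is unspecified otherwise);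
  the notions below are intended for connected graphs.
\<close>

definition graph_distance :: "('a, 'b) pre_digraph \<Rightarrow> 'a \<Rightarrow> 'a \<Rightarrow> nat" where
  "graph_distance G u v = (LEAST k. \<exists>p. pre_digraph.apath G u p v \<and> length p = k)"

text \<open>The distances are cast to integers because subtraction on \<^typ>\<open>nat\<close> truncates.\<close>

definition doubly_resolved :: "('a, 'b) pre_digraph \<Rightarrow> 'a \<Rightarrow> 'a \<Rightarrow> 'a \<Rightarrow> 'a \<Rightarrow> bool" where
  "doubly_resolved G u v x y \<longleftrightarrow>
     int (graph_distance G v x) - int (graph_distance G u x)
       \<noteq> int (graph_distance G v y) - int (graph_distance G u y)"

definition doubly_resolving_set :: "('a, 'b) pre_digraph \<Rightarrow> 'a set \<Rightarrow> bool" where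
  "doubly_resolving_set G W \<longleftrightarrow> W \<subseteq> verts G \<and>
     (\<forall>u\<in>verts G. \<forall>v\<in>verts G. u \<noteq> v \<longrightarrow> (\<exists>x\<in>W. \<exists>y\<in>W. doubly_resolved G u v x y))"

definition doubly_resolving_number :: "('a, 'b) pre_digraph \<Rightarrow> nat" where
  "doubly_resolving_number G =
     (LEAST k. \<exists>W. finite W \<and> doubly_resolving_set G W \<and> card W = k)"

end

theory Submission
  imports Defs
begin

text \<open>
  In a complete bipartite graph with nonempty parts \<open>U\<close> and \<open>V\<close> the distance of two vertices is \<open>0\<close>, \<open>1\<close>
  or \<open>2\<close>: they are equal, on different sides, or distinct on the same side. Fix vertices
  \<open>u \<noteq> v\<close> and write \<open>f w = d(v,w) - d(u,w)\<close>. A set \<open>W\<close> resolves the pair precisely when \<open>f\<close> is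
  not constant on \<open>W\<close>.

  If \<open>u\<close> and \<open>v\<close> are on the same side, \<open>f\<close> takes the values \<open>2\<close> at \<open>u\<close>, \<open>-2\<close> at \<open>v\<close>, and \<open>0\<close>
  elsewhere. So \<open>W\<close> must contain \<open>u\<close> or \<open>v\<close>, which means that a doubly resolving set omits at most
  one vertex of each part, and has at least \<open>n - 2\<close> elements. If \<open>u \<in> U\<close> and \<open>v \<in> V\<close>, then \<open>f\<close> is
  \<open>1\<close> on \<open>insert u (V - {v})\<close> and \<open>-1\<close> on the complementary set \<open>insert v (U - {u})\<close>, so \<open>W\<close>
  must meet both.

  Suppose that \<open>W\<close> omits exactly one vertex of each part. When \<open>r > 2\<close>, at least two vertices
  remain on each side, and these meet all the sets just named; thus \<open>n - 2\<close> is attained. When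
  \<open>r \<le> 2\<close>, at most one vertex of \<open>U\<close> remains. Let \<open>u\<close> be this vertex, or the only vertex of \<open>U\<close> if
  none remains, and let \<open>v \<in> V\<close> be omitted: then \<open>W\<close> lies inside \<open>insert u (V - {v})\<close> and leaves
  \<open>u\<close> and \<open>v\<close> unresolved. So a doubly resolving set must contain one of the parts, and has at least
  \<open>n - 1\<close> elements. Omitting a single vertex of the smaller part attains that bound.
\<close>

section \<open>Distances and resolved pairs in complete bipartite graphs\<close>

locale complete_bipartite = wf_digraph G for G :: "('a, 'b) pre_digraph" +
  fixes U V :: "'a set"
  assumes verts_eq: "verts G = U \<union> V"
    and disjoint: "U \<inter> V = {}"
    and nonempty: "U \<noteq> {}" "V \<noteq> {}"
    and arcs_ends_eq: "arcs_ends G = U \<times> V \<union> V \<times> U"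
begin

lemma swap: "complete_bipartite G V U"
  using verts_eq disjoint nonempty arcs_ends_eq by unfold_locales auto

lemma apath_length_one_iff:
  "(\<exists>p. apath u p v \<and> length p = 1) \<longleftrightarrow> (u, v) \<in> arcs_ends G \<and> u \<noteq> v"
proof
  show "\<exists>p. apath u p v \<and> length p = 1 \<Longrightarrow> (u, v) \<in> arcs_ends G \<and> u \<noteq> v"
    by (auto simp: length_Suc_conv apath_simps arcs_ends_conv)
next
  assume "(u, v) \<in> arcs_ends G \<and> u \<noteq> v"
  then obtain e where "e \<in> arcs G" "tail G e = u" "head G e = v" "u \<noteq> v"
    by (auto simp: arcs_ends_conv)
  then show "\<exists>p. apath u p v \<and> length p = 1"
    by (intro exI[of _ "[e]"]) (auto simp: apath_simps)
qed

lemma apath_length_two_iff: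
  "(\<exists>p. apath u p v \<and> length p = 2) \<longleftrightarrow>
     (\<exists>w. (u, w) \<in> arcs_ends G \<and> (w, v) \<in> arcs_ends G \<and> u \<noteq> w \<and> w \<noteq> v \<and> u \<noteq> v)"
  (is "?L \<longleftrightarrow> ?R")
proof
  assume ?L
  then show ?R
    by (fastforce simp: numeral_2_eq_2 length_Suc_conv apath_simps arcs_ends_conv)
next
  assume ?R
  then obtain w e e' where "e \<in> arcs G" "tail G e = u" "head G e = w"
    "e' \<in> arcs G" "tail G e' = w" "head G e' = v" "u \<noteq> w" "w \<noteq> v" "u \<noteq> v"
    by (auto simp: arcs_ends_conv)
  then have "apath u [e, e'] v"
    by (auto simp: apath_simps)
  then show ?L
    by (intro exI[of _ "[e, e']"]) simp
qed

lemma graph_distance_eq: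
  assumes "u \<in> verts G" "v \<in> verts G"
  shows "graph_distance G u v = (if u = v then 0 else if u \<in> U \<longleftrightarrow> v \<in> U then 2 else 1)"
proof -
  define P where "P k \<longleftrightarrow> (\<exists>p. apath u p v \<and> length p = k)" for k
  have P0: "P 0 \<longleftrightarrow> u = v"
    using assms by (auto simp: P_def apath_Nil_iff)
  have P1: "P 1 \<longleftrightarrow> (u \<in> U \<longleftrightarrow> v \<notin> U)"
    unfolding P_def apath_length_one_iff using assms verts_eq disjoint
    by (auto simp: arcs_ends_eq)
  have P2: "P 2" if "u \<noteq> v" "u \<in> U \<longleftrightarrow> v \<in> U"
    unfolding P_def apath_length_two_iff
  proof -
    obtain a b where "a \<in> U" "b \<in> V"
      using nonempty by blast
    then show "\<exists>w. (u, w) \<in> arcs_ends G \<and> (w, v) \<in> arcs_ends G \<and> u \<noteq> w \<and> w \<noteq> v \<and> u \<noteq> v"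
      using that assms verts_eq disjoint
      by (intro exI[of _ "if u \<in> U then b else a"]) (auto simp: arcs_ends_eq)
  qed
  have "(LEAST k. P k) = (if u = v then 0 else if u \<in> U \<longleftrightarrow> v \<in> U then 2 else 1)"
  proof (rule Least_equality)
    show "P (if u = v then 0 else if u \<in> U \<longleftrightarrow> v \<in> U then 2 else 1)"
      using P0 P1 P2 by auto
    show "(if u = v then 0 else if u \<in> U \<longleftrightarrow> v \<in> U then 2 else 1) \<le> k" if "P k" for k
      using that P0 P1 by (cases "k = 0"; cases "k = 1") auto
  qed
  then show ?thesis
    by (simp add: graph_distance_def P_def)
qed

lemma doubly_resolved_same_side_iff:
  assumes "u \<in> U" "v \<in> U" "u \<noteq> v" "x \<in> verts G" "y \<in> verts G"
  shows "doubly_resolved G u v x y \<longleftrightarrow> x \<noteq> y \<and> {x, y} \<inter> {u, v} \<noteq> {}"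
  using assms verts_eq disjoint by (auto simp: doubly_resolved_def graph_distance_eq)

text \<open>
  The set \<open>insert u (V - {v})\<close> is where \<open>d(v,w) - d(u,w)\<close> is \<open>1\<close>; this difference is \<open>-1\<close> at all
  other vertices.
\<close>

lemma doubly_resolved_across_iff:
  assumes "u \<in> U" "v \<in> V" "x \<in> verts G" "y \<in> verts G"
  shows "doubly_resolved G u v x y \<longleftrightarrow>
    (x \<in> insert u (V - {v}) \<longleftrightarrow> y \<notin> insert u (V - {v}))"
proof -
  have difference: "int (graph_distance G v w) - int (graph_distance G u w) =
      (if w \<in> insert u (V - {v}) then 1 else - 1)" if "w \<in> verts G" for w
    using that assms verts_eq disjoint by (auto simp: graph_distance_eq)
  show ?thesis
    using assms(3,4) by (simp add: doubly_resolved_def difference)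
qed

lemma doubly_resolved_commute: "doubly_resolved G u v x y \<longleftrightarrow> doubly_resolved G v u x y"
  by (auto simp: doubly_resolved_def)

section \<open>Necessary and sufficient conditions for doubly resolving sets\<close>

text \<open>
  The difference function is constant outside a pair on one side, so at least one of the two
  vertices must be chosen.
\<close>

lemma doubly_resolving_set_omits_at_most_one:
  assumes W: "doubly_resolving_set G W"
    and "u \<in> U - W" "v \<in> U - W"
  shows "u = v"
proof (rule ccontr)
  assume "u \<noteq> v"
  then obtain x y where "x \<in> W" "y \<in> W" "doubly_resolved G u v x y"
    using assms verts_eq unfolding doubly_resolving_set_def by blast
  moreover have "W \<subseteq> verts G"
    using W by (simp add: doubly_resolving_set_def)
  ultimately show False
    using doubly_resolved_same_side_iff[of u v x y] assms \<open>u \<noteq> v\<close> by auto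
qed

text \<open>
  If \<open>W\<close> has no vertex of \<open>U\<close> besides \<open>u\<close> and omits \<open>v \<in> V\<close>, it lies in the set where the
  difference function of \<open>u\<close> and \<open>v\<close> is \<open>1\<close>.
\<close>

lemma doubly_resolving_set_contains_other_part:
  assumes W: "doubly_resolving_set G W" and "u \<in> U" "W \<inter> U \<subseteq> {u}"
  shows "V \<subseteq> W"
proof
  fix v assume "v \<in> V"
  show "v \<in> W"
  proof (rule ccontr)
    assume "v \<notin> W"
    have "W \<subseteq> verts G"
      using W by (simp add: doubly_resolving_set_def)
    have "u \<noteq> v"
      using \<open>u \<in> U\<close> \<open>v \<in> V\<close> disjoint by auto
    then obtain x y where "x \<in> W" "y \<in> W" "doubly_resolved G u v x y"
      using W \<open>u \<in> U\<close> \<open>v \<in> V\<close> verts_eq unfolding doubly_resolving_set_def by blast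
    moreover have "W \<subseteq> insert u (V - {v})"
      using \<open>W \<subseteq> verts G\<close> \<open>v \<notin> W\<close> assms(3) verts_eq by auto
    ultimately show False
      using doubly_resolved_across_iff[of u v x y] \<open>W \<subseteq> verts G\<close> \<open>u \<in> U\<close> \<open>v \<in> V\<close> by auto
  qed
qed

text \<open>
  The last two hypotheses say that \<open>W\<close> meets both level sets of the difference function of a pair
  \<open>u \<in> U\<close>, \<open>v \<in> V\<close>. A same-side pair only needs a vertex of the pair and some further vertex of
  \<open>W\<close>.
\<close>

lemma doubly_resolving_setI:
  assumes sub: "W \<subseteq> verts G"
    and two: "a \<in> W" "b \<in> W" "a \<noteq> b"
    and omit_U: "\<And>u v. u \<in> U - W \<Longrightarrow> v \<in> U - W \<Longrightarrow> u = v"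
    and omit_V: "\<And>u v. u \<in> V - W \<Longrightarrow> v \<in> V - W \<Longrightarrow> u = v"
    and pos: "\<And>u v. u \<in> U \<Longrightarrow> v \<in> V \<Longrightarrow> W \<inter> insert u (V - {v}) \<noteq> {}"
    and neg: "\<And>u v. u \<in> U \<Longrightarrow> v \<in> V \<Longrightarrow> W \<inter> insert v (U - {u}) \<noteq> {}"
  shows "doubly_resolving_set G W"
proof -
  interpret swapped: complete_bipartite G V U
    by (rule swap)
  have other: "\<exists>y\<in>W. y \<noteq> x" for x
    using two by (cases "a = x") auto
  have U: "\<exists>x\<in>W. \<exists>y\<in>W. doubly_resolved G u v x y" if uv: "u \<in> U" "v \<in> U" "u \<noteq> v" for u v
  proof -
    obtain x where "x \<in> W" "x \<in> {u, v}"
      using uv omit_U by blast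
    moreover obtain y where "y \<in> W" "y \<noteq> x"
      using other by blast
    ultimately show ?thesis
      using doubly_resolved_same_side_iff[OF uv, of x y] sub by auto
  qed
  have V: "\<exists>x\<in>W. \<exists>y\<in>W. doubly_resolved G u v x y" if uv: "u \<in> V" "v \<in> V" "u \<noteq> v" for u v
  proof -
    obtain x where "x \<in> W" "x \<in> {u, v}"
      using uv omit_V by blast
    moreover obtain y where "y \<in> W" "y \<noteq> x"
      using other by blast
    ultimately show ?thesis
      using swapped.doubly_resolved_same_side_iff[OF uv, of x y] sub by auto
  qed
  have UV: "\<exists>x\<in>W. \<exists>y\<in>W. doubly_resolved G u v x y" if uv: "u \<in> U" "v \<in> V" for u v
  proof -
    obtain x where x: "x \<in> W" "x \<in> insert u (V - {v})"
      using pos[OF uv] by blast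
    obtain y where y: "y \<in> W" "y \<in> insert v (U - {u})"
      using neg[OF uv] by blast
    then have "y \<notin> insert u (V - {v})"
      using uv disjoint by auto
    then show ?thesis
      using doubly_resolved_across_iff[OF uv, of x y] x y sub by blast
  qed
  have "\<exists>x\<in>W. \<exists>y\<in>W. doubly_resolved G u v x y"
    if "u \<in> verts G" "v \<in> verts G" "u \<noteq> v" for u v
    using that U[of u v] V[of u v] UV[of u v] UV[of v u] doubly_resolved_commute[of u v]
    unfolding verts_eq by blast
  then show ?thesis
    using sub by (simp add: doubly_resolving_set_def)
qed

end

section \<open>Cardinalities\<close>

locale finite_complete_bipartite = complete_bipartite G U V
  for G :: "('a, 'b) pre_digraph" and U V +
  assumes finite_parts: "finite U" "finite V"
begin

lemma finite_doubly_resolving_set: "doubly_resolving_set G W \<Longrightarrow> finite W"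
  using finite_parts verts_eq by (auto simp: doubly_resolving_set_def intro: finite_subset)

lemma card_eq_omitted:
  assumes "doubly_resolving_set G W"
  shows "card U + card V = card W + card (U - W) + card (V - W)"
proof -
  have "W \<subseteq> U \<union> V"
    using assms verts_eq by (simp add: doubly_resolving_set_def)
  then have "U \<union> V = W \<union> ((U - W) \<union> (V - W))"
    by auto
  then have "card (U \<union> V) = card W + card ((U - W) \<union> (V - W))"
    using finite_parts finite_doubly_resolving_set[OF assms]
    by (metis Diff_disjoint Un_Diff card_Un_disjoint finite_Diff finite_Un)
  also have "card ((U - W) \<union> (V - W)) = card (U - W) + card (V - W)"
    using finite_parts disjoint by (intro card_Un_disjoint) auto
  finally show ?thesis
    using finite_parts disjoint by (simp add: card_Un_disjoint)
qed

lemma card_omitted_le_one: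
  assumes "doubly_resolving_set G W"
  shows "card (U - W) \<le> 1" "card (V - W) \<le> 1"
proof -
  interpret swapped: complete_bipartite G V U
    by (rule swap)
  show "card (U - W) \<le> 1"
    using doubly_resolving_set_omits_at_most_one[OF assms] finite_parts
    by (simp add: card_le_Suc0_iff_eq)
  show "card (V - W) \<le> 1"
    using swapped.doubly_resolving_set_omits_at_most_one[OF assms] finite_parts
    by (simp add: card_le_Suc0_iff_eq)
qed

lemma card_doubly_resolving_set_ge:
  assumes "doubly_resolving_set G W"
  shows "card U + card V - 2 \<le> card W"
  using card_eq_omitted[OF assms] card_omitted_le_one[OF assms] by simp

text \<open>
  If \<open>U\<close> has at most two vertices, a doubly resolving set that omits a vertex of \<open>U\<close> has
  at most one vertex of \<open>U\<close> left, and must then contain all of \<open>V\<close>: it cannot omit a vertex of each part.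
\<close>

lemma card_doubly_resolving_set_ge_small_part:
  assumes W: "doubly_resolving_set G W" and small: "card U \<le> 2"
  shows "card U + card V - 1 \<le> card W"
proof (cases "U \<subseteq> W")
  case True
  then have "card (U - W) = 0"
    by (simp add: Diff_eq_empty_iff[THEN iffD2])
  then show ?thesis
    using card_eq_omitted[OF W] card_omitted_le_one[OF W] by simp
next
  case False
  then obtain u0 where u0: "u0 \<in> U" "u0 \<notin> W"
    by blast
  have "card (U - {u0}) \<le> 1"
    using small u0 finite_parts by simp
  then obtain c where c: "U - {u0} \<subseteq> {c}"
    using finite_parts
    by (metis card_1_singletonE card_eq_0_iff empty_subsetI finite_Diff le_Suc_eq
        le_zero_eq One_nat_def subset_refl)
  (* If U is a singleton, no vertex of U is left, and u0 itself serves as the vertex u. *)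
  obtain u where "u \<in> U" "W \<inter> U \<subseteq> {u}"
    using c u0 by (cases "c \<in> U") auto
  then have "V \<subseteq> W"
    by (rule doubly_resolving_set_contains_other_part[OF W])
  then have "card (V - W) = 0"
    by (simp add: Diff_eq_empty_iff[THEN iffD2])
  then show ?thesis
    using card_eq_omitted[OF W] card_omitted_le_one[OF W] by simp
qed

text \<open>
  If \<open>V\<close> were a singleton \<open>{v}\<close>, the pair \<open>u0\<close>, \<open>v\<close> would be unresolved by the other vertices.
\<close>

lemma doubly_resolving_set_omit_one:
  assumes "u0 \<in> U" "2 \<le> card V"
  shows "doubly_resolving_set G (verts G - {u0})"
proof -
  obtain a where a: "a \<in> V"
    using nonempty by blast
  obtain b where b: "b \<in> V" "b \<noteq> a"
    using assms(2) finite_parts a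
    by (metis card_le_Suc0_iff_eq not_less_eq_eq numeral_2_eq_2)
  show ?thesis
  proof (rule doubly_resolving_setI[of _ a b])
    show "a \<in> verts G - {u0}" "b \<in> verts G - {u0}" "a \<noteq> b"
      using a b assms verts_eq disjoint by auto
    show "(verts G - {u0}) \<inter> insert u (V - {v}) \<noteq> {}" if "v \<in> V" for u v
      using a b assms verts_eq disjoint by (cases "v = a") blast+
    show "(verts G - {u0}) \<inter> insert v (U - {u}) \<noteq> {}" if "v \<in> V" for u v
      using that assms verts_eq disjoint by blast
  qed (use assms verts_eq disjoint in auto)
qed

text \<open>
  Each level set contains one part up to a single vertex, and the omission removes one more vertex
  of that part; a third one is left to represent the level set.
\<close>

lemma doubly_resolving_set_omit_two:
  assumes "u0 \<in> U" "v0 \<in> V" "3 \<le> card U" "3 \<le> card V"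
  shows "doubly_resolving_set G (verts G - {u0, v0})"
proof -
  have avoid: "\<exists>x\<in>A. x \<noteq> p \<and> x \<noteq> q" if "finite A" "3 \<le> card A" for A :: "'a set" and p q
  proof (rule ccontr)
    assume "\<not> ?thesis"
    then have "A \<subseteq> {p, q}"
      by blast
    then have "card A \<le> card {p, q}"
      by (intro card_mono) auto
    also have "\<dots> \<le> 2"
      by (simp add: card_insert_if)
    finally show False
      using that(2) by simp
  qed
  obtain a where a: "a \<in> U" "a \<noteq> u0"
    using avoid[OF finite_parts(1) assms(3)] by blast
  obtain b where b: "b \<in> V" "b \<noteq> v0"
    using avoid[OF finite_parts(2) assms(4)] by blast
  show ?thesis
  proof (rule doubly_resolving_setI[of _ a b])
    show "a \<in> verts G - {u0, v0}" "b \<in> verts G - {u0, v0}" "a \<noteq> b"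
      using a b assms verts_eq disjoint by auto
    show "(verts G - {u0, v0}) \<inter> insert u (V - {v}) \<noteq> {}" for u v
    proof -
      obtain w where "w \<in> V" "w \<noteq> v0" "w \<noteq> v"
        using avoid[OF finite_parts(2) assms(4)] by blast
      then show ?thesis
        using assms verts_eq disjoint by blast
    qed
    show "(verts G - {u0, v0}) \<inter> insert v (U - {u}) \<noteq> {}" for u v
    proof -
      obtain w where "w \<in> U" "w \<noteq> u0" "w \<noteq> u"
        using avoid[OF finite_parts(1) assms(3)] by blast
      then show ?thesis
        using assms verts_eq disjoint by blast
    qed
  qed (use assms verts_eq disjoint in auto)
qed

end

lemma doubly_resolving_number_eqI:
  assumes "finite W" "doubly_resolving_set G W" "card W = k"
    and "\<And>W'. finite W' \<Longrightarrow> doubly_resolving_set G W' \<Longrightarrow> k \<le> card W'"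
  shows "doubly_resolving_number G = k"
  unfolding doubly_resolving_number_def
  by (rule Least_equality) (use assms in auto)

theorem lemma2p3:
  fixes G :: "('a, 'b) pre_digraph" and r s n :: nat
  assumes "1 \<le> r" and "r \<le> s"
    and "complete_bipartite_digraph r s G"
    and "n = r + s" and "n \<ge> 3"
  shows "doubly_resolving_number G = (if r \<le> 2 then n - 1 else n - 2)"
proof -
  obtain U V where "graph G" and UV: "verts G = U \<union> V" "U \<inter> V = {}" "card U = r" "card V = s"
    "arcs_ends G = U \<times> V \<union> V \<times> U"
    using assms(3) unfolding complete_bipartite_digraph_def by blast
  interpret graph G
    by fact
  interpret finite_complete_bipartite G U V
    using UV assms(1,2) finite_verts by unfold_locales auto
  have card_verts: "card (verts G) = n"
    using UV assms(4) finite_parts by (simp add: card_Un_disjoint)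
  obtain u0 v0 where uv: "u0 \<in> U" "v0 \<in> V"
    using nonempty by blast
  show ?thesis
  proof (cases "r \<le> 2")
    case True
    have "doubly_resolving_number G = n - 1"
    proof (rule doubly_resolving_number_eqI)
      show "doubly_resolving_set G (verts G - {u0})"
        using doubly_resolving_set_omit_one uv UV assms by simp
      show "card (verts G - {u0}) = n - 1"
        using uv UV(1) card_verts by simp
      show "n - 1 \<le> card W" if "doubly_resolving_set G W" for W
        using card_doubly_resolving_set_ge_small_part[OF that] True UV assms(4) by simp
    qed simp
    with True show ?thesis
      by simp
  next
    case False
    have "doubly_resolving_number G = n - 2"
    proof (rule doubly_resolving_number_eqI)
      show "doubly_resolving_set G (verts G - {u0, v0})"
        using doubly_resolving_set_omit_two uv UV assms False by simp
      have "u0 \<noteq> v0"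
        using uv disjoint by blast
      then show "card (verts G - {u0, v0}) = n - 2"
        using uv UV(1) card_verts by (simp add: card_Diff_subset)
      show "n - 2 \<le> card W" if "doubly_resolving_set G W" for W
        using card_doubly_resolving_set_ge[OF that] UV assms(4) by simp
    qed simp
    with False show ?thesis
      by simp
  qed
qed

end
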